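(* Let $p\in[1,2]$ and $\frac1p+\frac1{p_1}=1$ (with $p_1=\infty$ if $p=1$). If $f\in L_p(\mathbb{R})$, then $\mathbb{F}_1f\in L_{p_1}(\mathbb{R})$, and moreover $$\|\mathbb{F}_1f\|_{L_{p_1}(\mathbb{R})}\le \mathcal{C}_2\,\|f\|_{L_p(\mathbb{R})},\qquad \mathcal{C}_2=C_1R^{2\left(1-\frac1p\right)},$$ where $R$ is the diameter of the compact support $M$ of the function $\psi$ and $C_1$ is a constant such that $|\psi(x,y)|\le C_1$ for all $(x,y)\in M$.
   Context: Let $a,b,c\in\mathbb{R}$ and let $\psi:\mathbb{R}^2\to\mathbb{C}$ be a smooth compactly supported function with support $M\subset\mathbb{R}^2$. The operator $\mathbb{F}_1$ is defined by $$(\mathbb{F}_1f)(x)=\int_{\mathbb{R}} e^{-ix(ay^2+by+c)}\,\psi(x,y)\,f(y)\,dy .$$ *)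

theory Defs
  imports "HOL-Probability.Essential_Supremum"
begin

primrec C_diff :: "nat \<Rightarrow> (real \<times> real \<Rightarrow> complex) \<Rightarrow> bool" where
  "C_diff 0 g \<longleftrightarrow> continuous_on UNIV g"
| "C_diff (Suc k) g \<longleftrightarrow>
     (\<forall>z. g differentiable (at z)) \<and>
     (\<forall>v. C_diff k (\<lambda>z. frechet_derivative g (at z) v))"

definition smooth :: "(real \<times> real \<Rightarrow> complex) \<Rightarrow> bool" where
  "smooth g \<longleftrightarrow> (\<forall>k. C_diff k g)"

definition supp :: "(real \<times> real \<Rightarrow> complex) \<Rightarrow> (real \<times> real) set" where
  "supp g = closure {z. g z \<noteq> 0}"

text \<open>Elements of the Lebesgue spaces are represented by functions, not by classes modulo
  equality almost everywhere. The exponent is extended so that \<open>\<infinity>\<close> is included; the definitions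
  are meant for \<open>p \<ge> 1\<close>.\<close>

definition in_Lp :: "ennreal \<Rightarrow> (real \<Rightarrow> complex) \<Rightarrow> bool" where
  "in_Lp p f \<longleftrightarrow> f \<in> borel_measurable lebesgue \<and>
     (if p = \<infinity> then esssup lebesgue (\<lambda>x. ennreal (norm (f x))) < \<infinity>
      else integrable lebesgue (\<lambda>x. norm (f x) powr enn2real p))"

definition Lp_norm :: "ennreal \<Rightarrow> (real \<Rightarrow> complex) \<Rightarrow> real" where
  "Lp_norm p f =
     (if p = \<infinity> then enn2real (esssup lebesgue (\<lambda>x. ennreal (norm (f x))))
      else (LINT x|lebesgue. norm (f x) powr enn2real p) powr (1 / enn2real p))"

definition F1 ::
  "real \<Rightarrow> real \<Rightarrow> real \<Rightarrow> (real \<times> real \<Rightarrow> complex) \<Rightarrow> (real \<Rightarrow> complex) \<Rightarrow> real \<Rightarrow> complex" where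
  "F1 a b c \<psi> f x =
     (LINT y|lebesgue. exp (- \<i> * complex_of_real (x * (a * y\<^sup>2 + b * y + c))) * \<psi> (x, y) * f y)"

end

theory Submission
  imports Defs
begin

text \<open>The integrand of \<open>F1 a b c \<psi> f x\<close> is dominated by \<open>C\<^sub>1 * norm (f y)\<close> on the section
  \<open>{y. (x, y) \<in> M}\<close>, which lies in an interval of length \<open>R\<close>. Hoelder's inequality on that interval bounds
  \<open>F1 a b c \<psi> f\<close> uniformly by \<open>C\<^sub>1 * R powr (1 - 1/p)\<close> times the norm of \<open>f\<close>. Since \<open>F1 a b c \<psi> f\<close> also vanishes
  outside an interval of length \<open>R\<close>, its \<open>p\<^sub>1\<close>-norm gains another factor \<open>R powr (1/p\<^sub>1)\<close>. Thus no
  interpolation is needed, and the oscillating factor plays no role.\<close>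

section \<open>Hoelder's inequality on a set of finite measure\<close>

text \<open>Young's inequality with weights \<open>1 / p\<close> and \<open>1 - 1 / p\<close>,
  applied to \<open>t powr p * s powr (1 - p)\<close> and \<open>s\<close>: in the weighted product
  the powers of \<open>s\<close> cancel and \<open>t\<close> remains. The free parameter
  \<open>s\<close> is there to be optimised.\<close>

lemma young_scaled:
  fixes t s p :: real
  assumes "0 \<le> t" "0 < s" "1 \<le> p"
  shows "t \<le> t powr p * (s powr (1 - p) / p) + (1 - 1 / p) * s"
proof (cases "t = 0")
  case False
  have "(t powr p * s powr (1 - p)) powr (1 / p) * s powr (1 - 1 / p)
      \<le> 1 / p * (t powr p * s powr (1 - p)) + (1 - 1 / p) * s"
    by (rule Youngs_inequality_0) (use assms False in auto)
  moreover have "(t powr p * s powr (1 - p)) powr (1 / p) * s powr (1 - 1 / p)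
      = t * (s powr ((1 - p) / p) * s powr (1 - 1 / p))"
    using assms False by (simp add: powr_mult powr_powr)
  moreover have "s powr ((1 - p) / p) * s powr (1 - 1 / p) = 1"
    using assms by (simp flip: powr_add add: field_simps)
  ultimately show ?thesis by simp
qed (use assms in simp)

text \<open>Integrating \<open>young_scaled\<close> over \<open>A\<close> bounds the integral for
  every \<open>s > 0\<close>; the choice \<open>s = 1\<close> gives integrability, the best
  \<open>s\<close> gives Hoelder's constant. This covers \<open>p = 1\<close> as well.\<close>

lemma hoelder_indicator:
  fixes f :: "'a \<Rightarrow> 'b::{real_normed_vector, second_countable_topology}"
  assumes [measurable]: "f \<in> borel_measurable M" "A \<in> sets M"
    and p: "1 \<le> p" and int: "integrable M (\<lambda>x. norm (f x) powr p)"
    and L: "0 < L" "emeasure M A \<le> ennreal L"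
  shows "integrable M (\<lambda>x. indicator A x * norm (f x))" (is ?integrable)
    and "(LINT x|M. indicator A x * norm (f x))
      \<le> L powr (1 - 1 / p) * (LINT x|M. norm (f x) powr p) powr (1 / p)" (is ?bound)
proof -
  define I where "I = (LINT x|M. norm (f x) powr p)"
  have fin: "emeasure M A < \<infinity>"
    using L(2) by (simp add: order_le_less_trans)
  have meas: "measure M A \<le> L"
    using L by (simp add: measure_def enn2real_leI)
  have pointwise: "indicator A x * norm (f x)
      \<le> norm (f x) powr p * (s powr (1 - p) / p) + (1 - 1 / p) * s * indicator A x"
    if "0 < s" for s x
    using young_scaled[of "norm (f x)" s p] that p by (auto simp: indicator_def)
  have int_rhs: "integrable M (\<lambda>x. norm (f x) powr p * (s powr (1 - p) / p) + (1 - 1 / p) * s * indicator A x)"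
    for s
    using int fin by (intro Bochner_Integration.integrable_add integrable_mult_left integrable_mult_right)
      (auto intro: integrable_real_indicator)
  show ?integrable
  proof (rule Bochner_Integration.integrable_bound[OF int_rhs[of 1]])
    show "AE x in M. norm (indicator A x * norm (f x))
        \<le> norm (norm (f x) powr p * (1 powr (1 - p) / p) + (1 - 1 / p) * 1 * indicator A x)"
    proof (rule AE_I2)
      fix x
      have "norm (indicator A x * norm (f x)) = indicator A x * norm (f x)" by simp
      also note pointwise[of 1 x, OF zero_less_one]
      finally show "norm (indicator A x * norm (f x))
        \<le> norm (norm (f x) powr p * (1 powr (1 - p) / p) + (1 - 1 / p) * 1 * indicator A x)"
        by simp
    qed
  qed measurable
  have le: "(LINT x|M. indicator A x * norm (f x)) \<le> I * (s powr (1 - p) / p) + (1 - 1 / p) * s * L"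
    if "0 < s" for s
  proof -
    have "(LINT x|M. indicator A x * norm (f x))
        \<le> (LINT x|M. norm (f x) powr p * (s powr (1 - p) / p) + (1 - 1 / p) * s * indicator A x)"
      using \<open>?integrable\<close> int_rhs pointwise[OF that] by (rule integral_mono)
    also have "\<dots> = I * (s powr (1 - p) / p) + (1 - 1 / p) * s * measure M A"
      unfolding I_def using int fin by (subst Bochner_Integration.integral_add) auto
    also have "\<dots> \<le> I * (s powr (1 - p) / p) + (1 - 1 / p) * s * L"
      using meas that p by (intro add_left_mono mult_left_mono) auto
    finally show ?thesis .
  qed
  have "0 \<le> I"
    unfolding I_def by (rule Bochner_Integration.integral_nonneg) simp
  show ?bound
  \<comment> \<open>For \<open>I = 0\<close> the minimising \<open>s\<close> would be
    \<open>0\<close>, outside the admissible range; there \<open>f\<close> vanishes almost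
    everywhere.\<close>
  proof (cases "I = 0")
    case True
    then have "AE x in M. norm (f x) powr p = 0"
      using int by (subst (asm) I_def, subst (asm) integral_nonneg_eq_0_iff_AE) auto
    then have "AE x in M. indicator A x * norm (f x) = 0"
      by eventually_elim auto
    then have "(LINT x|M. indicator A x * norm (f x)) = 0"
      by (rule integral_eq_zero_AE)
    then show ?thesis by simp
  next
    case False
    with \<open>0 \<le> I\<close> have "0 < I" by simp
    text \<open>This value minimises the bound \<open>le\<close>.\<close>
    define s where "s = (I / L) powr (1 / p)"
    \<comment> \<open>At this \<open>s\<close> both \<open>I * s powr (1 - p)\<close> and
      \<open>s * L\<close> equal \<open>B\<close>, so \<open>le\<close> becomes a convex combination
      of \<open>B\<close> with itself.\<close>
    define B where "B = L powr (1 - 1 / p) * I powr (1 / p)"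
    have "s * L = I powr (1 / p) * (L powr 1 / L powr (1 / p))"
      using L \<open>0 < I\<close> by (simp add: s_def powr_divide)
    then have 1: "s * L = B"
      using L by (simp add: B_def powr_diff)
    have "s powr (1 - p) = (I / L) powr (1 / p - 1)"
      using p by (simp add: s_def powr_powr diff_divide_distrib)
    also have "\<dots> = I powr (1 / p) / I * (L powr 1 / L powr (1 / p))"
      using L \<open>0 < I\<close> by (simp add: powr_divide powr_diff)
    finally have 2: "I * s powr (1 - p) = B"
      using L \<open>0 < I\<close> by (simp add: B_def powr_diff)
    have "(LINT x|M. indicator A x * norm (f x)) \<le> I * s powr (1 - p) / p + (1 - 1 / p) * (s * L)"
      using le[of s] L \<open>0 < I\<close> by (simp add: s_def mult.assoc)
    also have "\<dots> = B" unfolding 1 2 by (simp add: algebra_simps)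
    finally show ?thesis by (simp add: B_def I_def)
  qed
qed

section \<open>Uniform bound and continuity of the transform\<close>

text \<open>Starting the interval at \<open>Inf S\<close> keeps its length at \<open>R\<close>;
  centring it at a point of \<open>S\<close> would double it and spoil the constant.\<close>

lemma subset_interval_if_diff_le:
  fixes S :: "real set"
  assumes "\<And>u v. u \<in> S \<Longrightarrow> v \<in> S \<Longrightarrow> v - u \<le> R"
  obtains l where "S \<subseteq> {l..l + R}"
proof (cases "S = {}")
  case False
  then obtain w where "w \<in> S" by auto
  have bdd: "bdd_below S"
    using assms[OF _ \<open>w \<in> S\<close>] by (intro bdd_belowI[of _ "w - R"]) (simp add: algebra_simps)
  have "v - R \<le> Inf S" if "v \<in> S" for v
    using False assms[OF _ that] by (intro cInf_greatest) (auto simp: algebra_simps)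
  then have "S \<subseteq> {Inf S..Inf S + R}"
    using bdd by (auto intro: cInf_lower simp: algebra_simps)
  then show ?thesis by (rule that)
qed (use that in auto)

text \<open>Continuity follows by dominated convergence and serves to make the transform
  measurable.\<close>

lemma F1_bounds:
  assumes cont: "continuous_on UNIV \<psi>"
    and supp: "\<And>z. z \<notin> M \<Longrightarrow> \<psi> z = 0" and bound: "\<And>z. norm (\<psi> z) \<le> C"
    and M: "bounded M" and R: "R = diameter M" "0 < R"
    and p: "1 \<le> p" and f: "in_Lp (ennreal p) f"
  shows "continuous_on UNIV (F1 a b c \<psi> f)"
    and "norm (F1 a b c \<psi> f x) \<le> C * R powr (1 - 1 / p) * Lp_norm (ennreal p) f"
proof -
  have fm [measurable]: "f \<in> borel_measurable lebesgue"
    and fi: "integrable lebesgue (\<lambda>x. norm (f x) powr p)"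
    using f p by (auto simp: in_Lp_def)
  have N: "Lp_norm (ennreal p) f = (LINT x|lebesgue. norm (f x) powr p) powr (1 / p)"
    using p by (simp add: Lp_norm_def)
  have "0 \<le> C" using bound[of undefined] norm_ge_zero order_trans by blast
  define g where "g x y = exp (- \<i> * complex_of_real (x * (a * y\<^sup>2 + b * y + c))) * \<psi> (x, y) * f y" for x y
  have F1: "F1 a b c \<psi> f x = (LINT y|lebesgue. g x y)" for x
    by (simp add: F1_def g_def)
  have g_cont: "continuous_on UNIV (\<lambda>x. g x y)" for y
    unfolding g_def by (intro continuous_intros continuous_on_compose2[OF cont]) auto
  have "continuous_on UNIV (\<lambda>y. exp (- \<i> * complex_of_real (x * (a * y\<^sup>2 + b * y + c))) * \<psi> (x, y))" for x
    by (intro continuous_intros continuous_on_compose2[OF cont]) auto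
  then have "(\<lambda>y. exp (- \<i> * complex_of_real (x * (a * y\<^sup>2 + b * y + c))) * \<psi> (x, y)) \<in> borel_measurable lebesgue" for x
    by (intro measurable_completion) (simp add: borel_measurable_continuous_onI)
  then have g_meas [measurable]: "g x \<in> borel_measurable lebesgue" for x
    unfolding g_def by (rule borel_measurable_times) (rule fm)
  have g_le: "norm (g x y) \<le> C * norm (f y)" for x y
    using bound[of "(x, y)"] by (simp add: g_def norm_mult mult_right_mono)
  have g_0: "g x y = 0" if "(x, y) \<notin> M" for x y
    using supp[OF that] by (simp add: g_def)
  have dist_le: "dist z w \<le> R" if "z \<in> M" "w \<in> M" for z w
    using diameter_bounded_bound[OF M that] R by simp
  \<comment> \<open>Since \<open>x\<close> and \<open>x'\<close> may differ, this serves single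
    sections as well as the whole projection of \<open>M\<close>.\<close>
  have diff_le: "v - u \<le> R" if "(x, u) \<in> M" "(x', v) \<in> M" for x x' u v
    using order_trans[OF dist_snd_le dist_le[OF that]] by (simp add: dist_real_def)
  have hoelder: "integrable lebesgue (\<lambda>y. C * (indicator {l..l + R} y * norm (f y)))"
    "(LINT y|lebesgue. C * (indicator {l..l + R} y * norm (f y))) \<le> C * R powr (1 - 1 / p) * Lp_norm (ennreal p) f"
    for l
    using hoelder_indicator[OF fm _ p fi \<open>0 < R\<close>, of "{l..l + R}"] R \<open>0 \<le> C\<close>
    by (auto simp: N mult.assoc intro!: mult_left_mono)
  show "norm (F1 a b c \<psi> f x) \<le> C * R powr (1 - 1 / p) * Lp_norm (ennreal p) f"
  proof -
    obtain l where l: "{y. (x, y) \<in> M} \<subseteq> {l..l + R}"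
      by (rule subset_interval_if_diff_le[of "{y. (x, y) \<in> M}" R]) (use diff_le in auto)
    have "norm (F1 a b c \<psi> f x) \<le> (LINT y|lebesgue. norm (g x y))"
      unfolding F1 by (rule integral_norm_bound)
    also have "\<dots> \<le> (LINT y|lebesgue. C * (indicator {l..l + R} y * norm (f y)))"
    proof (rule integral_mono')
      show "norm (g x y) \<le> C * (indicator {l..l + R} y * norm (f y))" for y
        using g_le[of x y] g_0[of x y] l \<open>0 \<le> C\<close> by (cases "(x, y) \<in> M") auto
    qed (use hoelder(1) \<open>0 \<le> C\<close> in auto)
    also note hoelder(2)
    finally show ?thesis .
  qed
  \<comment> \<open>The dominating function must not depend on \<open>x\<close>, so one interval has
    to contain all sections at once.\<close>
  obtain l where l: "snd ` M \<subseteq> {l..l + R}"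
    by (rule subset_interval_if_diff_le[of "snd ` M" R]) (use diff_le in auto)
  show "continuous_on UNIV (F1 a b c \<psi> f)"
  proof (rule continuous_on_sequentiallyI)
    fix u :: "nat \<Rightarrow> real" and x
    assume u: "u \<longlonglongrightarrow> x"
    show "(\<lambda>n. F1 a b c \<psi> f (u n)) \<longlonglongrightarrow> F1 a b c \<psi> f x"
      unfolding F1
    proof (rule integral_dominated_convergence[OF _ _ hoelder(1)[of l]])
      show "AE y in lebesgue. (\<lambda>n. g (u n) y) \<longlonglongrightarrow> g x y"
        using continuous_on_tendsto_compose[OF g_cont u] by simp
      show "AE y in lebesgue. norm (g (u n) y) \<le> C * (indicator {l..l + R} y * norm (f y))" for n
      proof (rule AE_I2)
        show "norm (g (u n) y) \<le> C * (indicator {l..l + R} y * norm (f y))" for y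
          using g_le[of "u n" y] g_0[of "u n" y] l \<open>0 \<le> C\<close> by (cases "(u n, y) \<in> M") force+
      qed
    qed measurable
  qed
qed

section \<open>Norms of bounded functions\<close>

lemma Lp_norm_le_interval:
  fixes h :: "real \<Rightarrow> complex"
  assumes [measurable]: "h \<in> borel_measurable lebesgue"
    and q: "0 < q" and R: "0 \<le> R"
    and bound: "\<And>x. norm (h x) \<le> B" and zero: "\<And>x. x \<notin> {l..l + R} \<Longrightarrow> h x = 0"
  shows "in_Lp (ennreal q) h" and "Lp_norm (ennreal q) h \<le> B * R powr (1 / q)"
proof -
  have "0 \<le> B" using bound[of 0] norm_ge_zero order_trans by blast
  have le: "norm (h x) powr q \<le> B powr q * indicator {l..l + R} x" for x
    using bound[of x] zero[of x] q by (cases "x \<in> {l..l + R}") (auto intro: powr_mono2)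
  have int: "integrable lebesgue (\<lambda>x. B powr q * indicator {l..l + R} x)"
    by (intro integrable_mult_right integrable_real_indicator) (auto simp: R)
  have h_int: "integrable lebesgue (\<lambda>x. norm (h x) powr q)"
    by (rule Bochner_Integration.integrable_bound[OF int]) (use le in auto)
  then show "in_Lp (ennreal q) h"
    using q by (simp add: in_Lp_def)
  have "(LINT x|lebesgue. norm (h x) powr q) \<le> (LINT x|lebesgue. B powr q * indicator {l..l + R} x)"
    by (rule integral_mono[OF h_int int le])
  also have "\<dots> = B powr q * R"
    using R by simp
  finally have "(LINT x|lebesgue. norm (h x) powr q) powr (1 / q) \<le> (B powr q * R) powr (1 / q)"
    using q by (intro powr_mono2) (auto intro: Bochner_Integration.integral_nonneg)
  also have "\<dots> = B * R powr (1 / q)"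
    using q R \<open>0 \<le> B\<close> by (simp add: powr_mult powr_powr)
  finally show "Lp_norm (ennreal q) h \<le> B * R powr (1 / q)"
    using q by (simp add: Lp_norm_def)
qed

lemma Linf_norm_le:
  fixes h :: "real \<Rightarrow> complex"
  assumes [measurable]: "h \<in> borel_measurable lebesgue" and bound: "\<And>x. norm (h x) \<le> B"
  shows "in_Lp \<infinity> h" and "Lp_norm \<infinity> h \<le> B"
proof -
  have "0 \<le> B" using bound[of 0] norm_ge_zero order_trans by blast
  have le: "esssup lebesgue (\<lambda>x. ennreal (norm (h x))) \<le> ennreal B"
    by (rule esssup_I) (use bound in \<open>auto intro: ennreal_leI\<close>)
  then show "in_Lp \<infinity> h"
    by (simp add: in_Lp_def order_le_less_trans)
  show "Lp_norm \<infinity> h \<le> B"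
    using le \<open>0 \<le> B\<close> by (simp add: Lp_norm_def enn2real_leI)
qed

section \<open>Positive diameter and conjugate exponents\<close>

text \<open>A small closed ball fits into \<open>U\<close>. With \<open>U\<close> the set where
  \<open>\<psi>\<close> is nonzero, this supplies the positive length that
  \<open>hoelder_indicator\<close> asks for.\<close>

lemma diameter_pos_open_subset:
  fixes M :: "'a::euclidean_space set"
  assumes "bounded M" "open U" "U \<subseteq> M" "U \<noteq> {}"
  shows "0 < diameter M"
proof -
  obtain x e where "0 < e" "cball x e \<subseteq> U"
    using assms(2,4) open_contains_cball by blast
  then have "diameter (cball x e) \<le> diameter M"
    using assms by (intro diameter_subset) auto
  with \<open>0 < e\<close> show ?thesis by simp
qed

text \<open>In \<open>ennreal\<close>, \<open>1 / \<infinity>\<close> is \<open>0\<close>, which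
  forces \<open>p = 1\<close>, while \<open>1 / 0\<close> is \<open>\<infinity>\<close>, which
  excludes \<open>p\<^sub>1 = 0\<close>.\<close>

lemma conjugate_exponent_cases:
  assumes p: "1 \<le> p" and conj: "1 / ennreal p + 1 / p\<^sub>1 = 1"
  obtains "p = 1" "p\<^sub>1 = \<infinity>" | q where "1 < p" "0 < q" "p\<^sub>1 = ennreal q" "1 / q = 1 - 1 / p"
proof (cases p\<^sub>1)
  case top
  have "ennreal (1 / p) = 1"
    using conj p divide_ennreal[of 1 p] by (simp add: top)
  then show ?thesis using that(1) p top by simp
next
  case (real q)
  have "q \<noteq> 0"
    using conj real by (auto simp: ennreal_divide_zero)
  with real have "0 < q" by simp
  have "ennreal (1 / p + 1 / q) = 1"
    using conj p divide_ennreal[of 1 p] divide_ennreal[of 1 q] \<open>0 < q\<close> by (simp add: real)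
  then have "1 / p + 1 / q = 1" by simp
  moreover from this have "1 < p"
    using p \<open>0 < q\<close> by (cases "p = 1") auto
  ultimately show ?thesis using that(2)[of q] real \<open>0 < q\<close> by simp
qed

theorem theorem2p2:
  fixes a b c p C\<^sub>1 R :: real
    and p\<^sub>1 :: ennreal
    and \<psi> :: "real \<times> real \<Rightarrow> complex"
    and M :: "(real \<times> real) set"
    and f :: "real \<Rightarrow> complex"
  assumes "smooth \<psi>"
    and "M = supp \<psi>" and "compact M"
    and "R = diameter M"
    and "\<forall>z\<in>M. norm (\<psi> z) \<le> C\<^sub>1"
    and "1 \<le> p" and "p \<le> 2"
    and "1 / ennreal p + 1 / p\<^sub>1 = 1"
    and "in_Lp (ennreal p) f"
  shows "in_Lp p\<^sub>1 (F1 a b c \<psi> f) \<and>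
    Lp_norm p\<^sub>1 (F1 a b c \<psi> f) \<le> (C\<^sub>1 * R powr (2 * (1 - 1 / p))) * Lp_norm (ennreal p) f"
proof -
  let ?h = "F1 a b c \<psi> f" and ?N = "Lp_norm (ennreal p) f" and ?U = "{z. \<psi> z \<noteq> 0}"
  have "C_diff 0 \<psi>"
    using assms(1) unfolding smooth_def by blast
  then have cont: "continuous_on UNIV \<psi>" by simp
  have zero: "\<psi> z = 0" if "z \<notin> M" for z
    using that closure_subset[of ?U] assms(2) by (auto simp: supp_def)
  have h_zero: "?h x = 0" if "x \<notin> fst ` M" for x
  proof -
    have "\<psi> (x, y) = 0" for y using that by (intro zero) force
    then show ?thesis by (simp add: F1_def)
  qed
  have bdd: "bounded M" by (rule compact_imp_bounded) fact
  show ?thesis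
  proof (cases "M = {}")
    case True
    text \<open>Here \<open>C\<^sub>1\<close> may be negative, but \<open>R = 0\<close> and \<open>0 powr t = 0\<close> also for \<open>t = 0\<close>.\<close>
    then have h0: "?h = (\<lambda>x. 0)" using h_zero by auto
    have "R = 0" using True assms(4) by simp
    show ?thesis
      using assms(6,8)
    proof (cases rule: conjugate_exponent_cases)
      case 1
      with Linf_norm_le[of ?h 0] h0 \<open>R = 0\<close> show ?thesis by simp
    next
      case (2 q)
      with Lp_norm_le_interval[of ?h q 0 0 0] h0 \<open>R = 0\<close> show ?thesis by simp
    qed
  next
    case False
    have "?U \<noteq> {}"
      using False assms(2) by (auto simp: supp_def)
    moreover have "open ?U"
      using open_Collect_neq[OF cont continuous_on_const] by simp
    moreover have "?U \<subseteq> M" using zero by auto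
    ultimately have R: "0 < R"
      using diameter_pos_open_subset[OF bdd] assms(4) by simp
    \<comment> \<open>A point of \<open>M\<close> forces the sign of \<open>C\<^sub>1\<close>, and
      the bound then extends to points outside \<open>M\<close>, where \<open>\<psi>\<close> is
      \<open>0\<close>.\<close>
    have "0 \<le> C\<^sub>1"
      using False assms(5) norm_ge_zero order_trans by blast
    then have bound: "norm (\<psi> z) \<le> C\<^sub>1" for z
      using assms(5) zero[of z] by (cases "z \<in> M") auto
    note F = F1_bounds[OF cont zero bound bdd assms(4) R assms(6,9)]
    have hm: "?h \<in> borel_measurable lebesgue"
      using F(1) by (intro measurable_completion) (simp add: borel_measurable_continuous_onI)
    have "v - u \<le> R" if "u \<in> fst ` M" "v \<in> fst ` M" for u v
    proof -
      from that obtain z w where "z \<in> M" "w \<in> M" "u = fst z" "v = fst w" by auto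
      then have "dist u v \<le> R"
        using dist_fst_le[of z w] diameter_bounded_bound[OF bdd, of z w] assms(4) by simp
      then show ?thesis by (simp add: dist_real_def)
    qed
    then obtain l where l: "fst ` M \<subseteq> {l..l + R}"
      by (rule subset_interval_if_diff_le)
    show ?thesis
      using assms(6,8)
    proof (cases rule: conjugate_exponent_cases)
      case 1
      \<comment> \<open>For \<open>p = 1\<close> the exponents \<open>1 - 1 / p\<close> and
        \<open>2 * (1 - 1 / p)\<close> are both \<open>0\<close>, so the uniform bound is already
        the claim.\<close>
      with Linf_norm_le[OF hm F(2)] R show ?thesis by simp
    next
      case (2 q)
      have "?h x = 0" if "x \<notin> {l..l + R}" for x
        using h_zero l that by blast
      note L = Lp_norm_le_interval[where l = l, OF hm \<open>0 < q\<close> less_imp_le[OF R] F(2) this]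
      \<comment> \<open>One factor comes from Hoelder's inequality in \<open>y\<close>, the other
        from the extent of \<open>M\<close> in \<open>x\<close>, because
        \<open>1 / q = 1 - 1 / p\<close>.\<close>
      have "R powr (2 * (1 - 1 / p)) = R powr (1 - 1 / p) * R powr (1 - 1 / p)"
        by (simp flip: powr_add)
      with L 2 show ?thesis by (simp add: mult_ac)
    qed
  qed
qed

end
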